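(* Let $(\mathfrak{g}_{6,4}^s,B)$ be the complex quadratic Lie superalgebra with even basis $X_0,X_1$, odd basis $Y_1,Y_2,Y_3,Y_4$, $B(X_0,X_1)=B(Y_4,Y_1)=B(Y_3,Y_2)=1$ and non-trivial brackets $[X_1,Y_1]=-[Y_1,X_1]=-Y_2$, $[X_1,Y_3]=-[Y_3,X_1]=Y_4$, $[Y_3,Y_1]=[Y_1,Y_3]=X_0$, endowed with a symplectic structure $\omega(X_0,X_1)=b_1'+c_3'$, $\omega(Y_4,Y_1)=-b_1'$, $\omega(Y_3,Y_2)=c_3'$, $\omega(Y_1,Y_1)=b_4'$, $\omega(Y_1,Y_3)=-b_2'$, $\omega(Y_3,Y_3)=-c_2'$, with $b_1',b_2',b_4',c_2',c_3'\in\mathbb{C}$, $b_1',c_3'\neq 0$, $b_1'\neq -c_3'$. Let $D$ be an even nilpotent skew-supersymmetric superderivation of $(\mathfrak{g}_{6,4}^s,B)$ and let $(\mathfrak{g},\widetilde{B})$ be the double extension of $(\mathfrak{g}_{6,4}^s,B)$ by the one-dimensional Lie algebra $(\mathbb{C}e)_{\bar 0}$ by means of $D$. Then $(\mathfrak{g},\widetilde{B})$ admits a symplectic structure $\widetilde\omega$, so that $(\mathfrak{g},\widetilde{B},\widetilde{\omega})$ is a quadratic symplectic Lie superalgebra, and $(\mathfrak g,\widetilde B)$ is i-isomorphic to a member of the following family: $$\begin{array}{l} [e,Y_1]=-[Y_1,e]=b_2Y_2+b_4Y_4,\\ {}[e,Y_3]=-[Y_3,e]=c_2Y_2-b_2Y_4,\\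 {}[X_1,Y_1]=-[Y_1,X_1]=-Y_2,\\ {}[X_1,Y_3]=-[Y_3,X_1]=Y_4,\\ {}[Y_1,Y_3]=[Y_3,Y_1]=X_0-b_2e^*,\\ {}[Y_1,Y_1]=b_4e^*,\\ {}[Y_3,Y_3]=-c_2e^*, \end{array}$$ where $b_2,b_4,c_2\in\mathbb{C}$ satisfy $(b_2,b_4,c_2)\neq(0,0,0)$, $\{X_0,X_1,e,e^*\}$ is a basis of $\mathfrak{g}_{\bar 0}$, $\{Y_1,Y_2,Y_3,Y_4\}$ is a basis of $\mathfrak{g}_{\bar 1}$ (and the invariant scalar product is $\widetilde{B}(X_0,X_1)=\widetilde{B}(Y_4,Y_1)=\widetilde{B}(Y_3,Y_2)=\widetilde{B}(e^*,e)=1$). Moreover, the symplectic structure can be given by $\widetilde{\omega}(X,Y)=\widetilde{B}(\delta(X),Y)$, where $\delta$ is the even invertible skew-supersymmetric superderivation of $(\mathfrak{g},\widetilde{B})$ given in the ordered basis $(X_0,X_1,e,e^*,Y_1,Y_2,Y_3,Y_4)$ by the matrix $$2E^{1,1}-2E^{2,2}-2E^{3,3}+2E^{4,4}+E^{5,5}-E^{6,6}+E^{7,7}-E^{8,8}.$$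
   Context: A Lie superalgebra is a $\mathbb{Z}_2$-graded vector space $\mathfrak{g}=\mathfrak{g}_{\bar 0}\oplus\mathfrak{g}_{\bar 1}$ with an even bilinear bracket satisfying, for homogeneous $X,Y,Z$ of degrees $x,y,z$, $[X,Y]=-(-1)^{xy}[Y,X]$ and $(-1)^{xz}[X,[Y,Z]]+(-1)^{xy}[Y,[Z,X]]+(-1)^{yz}[Z,[X,Y]]=0$. A bilinear form $F$ is even if $F(\mathfrak{g}_{\bar 0},\mathfrak{g}_{\bar 1})=F(\mathfrak{g}_{\bar 1},\mathfrak{g}_{\bar 0})=\{0\}$. $(\mathfrak{g},B)$ is quadratic if $B$ is an even, non-degenerate, supersymmetric ($B(X,Y)=(-1)^{xy}B(Y,X)$), invariant ($B([X,Y],Z)=B(X,[Y,Z])$) bilinear form (an invariant scalar product). A symplectic structure is an even, non-degenerate, skew-supersymmetric ($\omega(X,Y)=-(-1)^{xy}\omega(Y,X)$) bilinear form with $(-1)^{xz}\omega(X,[Y,Z])+(-1)^{yx}\omega(Y,[Z,X])+(-1)^{zy}\omega(Z,[X,Y])=0$. A quadratic symplectic Lie superalgebra carries both. An even superderivation is a degree-preserving linear map $D$ with $D([X,Y])=[D(X),Y]+[X,D(Y)]$; it is skew-supersymmetric if $B(D(X),Y)=-B(X,D(Y))$. Two quadratic Lie superalgebras are i-isomorphic if there is a Lie superalgebra isomorphism between them preserving the invariant scalar products. $E^{i,j}$ denotes the matrix unit with $1$ in position $(i,j)$. Brackets and values of forms on basis vectors not listed and not determined by (skew-)supersymmetry are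 zero. Double extension of $(\mathfrak{a},B)$ by $(\mathbb{K}e)_{\bar 0}$ by means of an even skew-supersymmetric superderivation $D$: $\mathfrak{g}=\mathbb{K}e\oplus\mathfrak{a}\oplus\mathbb{K}e^*$ with $e,e^*$ even, $[e,X]=D(X)$, $[X,Y]=[X,Y]_{\mathfrak{a}}+B(D(X),Y)e^*$ for $X,Y\in\mathfrak{a}$, $[e^*,\mathfrak{g}]=\{0\}$, and $\widetilde{B}|_{\mathfrak{a}\times\mathfrak{a}}=B$, $\widetilde{B}(e^*,e)=1$, $\widetilde{B}(\mathfrak{a},e)=\widetilde{B}(\mathfrak{a},e^* )=\{0\}$, $\widetilde{B}(e,e)=\widetilde{B}(e^*,e^* )=0$. *)

theory Defs
  imports "HOL-Analysis.Cartesian_Space" "HOL-Library.Z2"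
begin

section \<open>Lie superalgebras\<close>

text \<open>Degrees are elements of the two-element field \<^typ>\<open>bit\<close>; the underlying vector space is
  the whole type \<open>'v\<close> with scalar multiplication \<open>scl\<close>.\<close>

record ('k, 'v) superalgebra =
  scl :: "'k \<Rightarrow> 'v \<Rightarrow> 'v"
  grade :: "bit \<Rightarrow> 'v set"
  brk :: "'v \<Rightarrow> 'v \<Rightarrow> 'v"

text \<open>\<open>sg d\<close> is \<open>(-1)^d\<close>, so that \<open>sg (x * y)\<close> is \<open>(-1)^{xy}\<close>.\<close>

definition sg :: "bit \<Rightarrow> 'k::field" where
  "sg d = (if d = 0 then 1 else -1)"

definition bilinear_map ::
    "('k::field \<Rightarrow> 'v::ab_group_add \<Rightarrow> 'v) \<Rightarrow> ('k \<Rightarrow> 'w::ab_group_add \<Rightarrow> 'w) \<Rightarrow> ('v \<Rightarrow> 'v \<Rightarrow> 'w) \<Rightarrow> bool" where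
  "bilinear_map s t f \<longleftrightarrow>
     (\<forall>X. Vector_Spaces.linear s t (\<lambda>Y. f X Y)) \<and> (\<forall>Y. Vector_Spaces.linear s t (\<lambda>X. f X Y))"

definition graded_vector_space :: "('k::field, 'v::ab_group_add) superalgebra \<Rightarrow> bool" where
  "graded_vector_space L \<longleftrightarrow>
     vector_space (scl L) \<and>
     (\<forall>i. module.subspace (scl L) (grade L i)) \<and>
     grade L 0 \<inter> grade L 1 = {0} \<and>
     (\<forall>X. \<exists>U \<in> grade L 0. \<exists>V \<in> grade L 1. X = U + V)"

definition lie_superalgebra :: "('k::field, 'v::ab_group_add) superalgebra \<Rightarrow> bool" where
  "lie_superalgebra L \<longleftrightarrow>
     graded_vector_space L \<and>
     bilinear_map (scl L) (scl L) (brk L) \<and>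
     (\<forall>x y. \<forall>X \<in> grade L x. \<forall>Y \<in> grade L y. brk L X Y \<in> grade L (x + y)) \<and>
     (\<forall>x y. \<forall>X \<in> grade L x. \<forall>Y \<in> grade L y.
        brk L X Y = - scl L (sg (x * y)) (brk L Y X)) \<and>
     (\<forall>x y z. \<forall>X \<in> grade L x. \<forall>Y \<in> grade L y. \<forall>Z \<in> grade L z.
        scl L (sg (x * z)) (brk L X (brk L Y Z)) +
        scl L (sg (x * y)) (brk L Y (brk L Z X)) +
        scl L (sg (y * z)) (brk L Z (brk L X Y)) = 0)"

definition even_form :: "('k::field, 'v::ab_group_add) superalgebra \<Rightarrow> ('v \<Rightarrow> 'v \<Rightarrow> 'k) \<Rightarrow> bool" where
  "even_form L F \<longleftrightarrow>
     bilinear_map (scl L) (*) F \<and>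
     (\<forall>X \<in> grade L 0. \<forall>Y \<in> grade L 1. F X Y = 0 \<and> F Y X = 0)"

definition nondegenerate_form :: "('v::ab_group_add \<Rightarrow> 'v \<Rightarrow> 'k::field) \<Rightarrow> bool" where
  "nondegenerate_form F \<longleftrightarrow>
     (\<forall>X. (\<forall>Y. F X Y = 0) \<longrightarrow> X = 0) \<and> (\<forall>Y. (\<forall>X. F X Y = 0) \<longrightarrow> Y = 0)"

definition invariant_scalar_product ::
    "('k::field, 'v::ab_group_add) superalgebra \<Rightarrow> ('v \<Rightarrow> 'v \<Rightarrow> 'k) \<Rightarrow> bool" where
  "invariant_scalar_product L B \<longleftrightarrow>
     even_form L B \<and> nondegenerate_form B \<and>
     (\<forall>x y. \<forall>X \<in> grade L x. \<forall>Y \<in> grade L y. B X Y = sg (x * y) * B Y X) \<and>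
     (\<forall>X Y Z. B (brk L X Y) Z = B X (brk L Y Z))"

definition quadratic ::
    "('k::field, 'v::ab_group_add) superalgebra \<Rightarrow> ('v \<Rightarrow> 'v \<Rightarrow> 'k) \<Rightarrow> bool" where
  "quadratic L B \<longleftrightarrow> lie_superalgebra L \<and> invariant_scalar_product L B"

definition symplectic_structure ::
    "('k::field, 'v::ab_group_add) superalgebra \<Rightarrow> ('v \<Rightarrow> 'v \<Rightarrow> 'k) \<Rightarrow> bool" where
  "symplectic_structure L \<omega> \<longleftrightarrow>
     even_form L \<omega> \<and> nondegenerate_form \<omega> \<and>
     (\<forall>x y. \<forall>X \<in> grade L x. \<forall>Y \<in> grade L y. \<omega> X Y = - sg (x * y) * \<omega> Y X) \<and>
     (\<forall>x y z. \<forall>X \<in> grade L x. \<forall>Y \<in> grade L y. \<forall>Z \<in> grade L z.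
        sg (x * z) * \<omega> X (brk L Y Z) +
        sg (y * x) * \<omega> Y (brk L Z X) +
        sg (z * y) * \<omega> Z (brk L X Y) = 0)"

definition quadratic_symplectic ::
    "('k::field, 'v::ab_group_add) superalgebra \<Rightarrow> ('v \<Rightarrow> 'v \<Rightarrow> 'k) \<Rightarrow> ('v \<Rightarrow> 'v \<Rightarrow> 'k) \<Rightarrow> bool" where
  "quadratic_symplectic L B \<omega> \<longleftrightarrow> quadratic L B \<and> symplectic_structure L \<omega>"

definition even_superderivation ::
    "('k::field, 'v::ab_group_add) superalgebra \<Rightarrow> ('v \<Rightarrow> 'v) \<Rightarrow> bool" where
  "even_superderivation L D \<longleftrightarrow>
     Vector_Spaces.linear (scl L) (scl L) D \<and>
     (\<forall>i. D ` grade L i \<subseteq> grade L i) \<and>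
     (\<forall>X Y. D (brk L X Y) = brk L (D X) Y + brk L X (D Y))"

definition skew_supersymmetric :: "('v \<Rightarrow> 'v \<Rightarrow> 'k::field) \<Rightarrow> ('v \<Rightarrow> 'v) \<Rightarrow> bool" where
  "skew_supersymmetric B D \<longleftrightarrow> (\<forall>X Y. B (D X) Y = - B X (D Y))"

definition nilpotent_map :: "('v::zero \<Rightarrow> 'v) \<Rightarrow> bool" where
  "nilpotent_map D \<longleftrightarrow> (\<exists>n. \<forall>X. (D ^^ n) X = 0)"

definition i_isomorphism ::
    "('k::field, 'v::ab_group_add) superalgebra \<Rightarrow> ('v \<Rightarrow> 'v \<Rightarrow> 'k) \<Rightarrow>
     ('k, 'w::ab_group_add) superalgebra \<Rightarrow> ('w \<Rightarrow> 'w \<Rightarrow> 'k) \<Rightarrow> ('v \<Rightarrow> 'w) \<Rightarrow> bool" where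
  "i_isomorphism L B L' B' \<phi> \<longleftrightarrow>
     quadratic L B \<and> quadratic L' B' \<and>
     Vector_Spaces.linear (scl L) (scl L') \<phi> \<and> bij \<phi> \<and>
     (\<forall>i. \<phi> ` grade L i = grade L' i) \<and>
     (\<forall>X Y. \<phi> (brk L X Y) = brk L' (\<phi> X) (\<phi> Y)) \<and>
     (\<forall>X Y. B' (\<phi> X) (\<phi> Y) = B X Y)"

section \<open>Double extension by an even one-dimensional Lie algebra\<close>

text \<open>The triple \<open>(\<alpha>, X, \<beta>)\<close> stands for \<open>\<alpha> e + X + \<beta> e\<^sup>*\<close>.  The terms \<open>- \<alpha>' D(X)\<close> of the bracket
  and \<open>\<alpha> \<beta>'\<close> of the form are the values \<open>[X, e] = -[e, X]\<close> and \<open>B(e, e\<^sup>*) = B(e\<^sup>*, e)\<close>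
  forced by (skew-)supersymmetry, as \<open>e\<close> and \<open>e\<^sup>*\<close> are even.\<close>

definition double_ext ::
    "('k::field, 'v::ab_group_add) superalgebra \<Rightarrow> ('v \<Rightarrow> 'v \<Rightarrow> 'k) \<Rightarrow> ('v \<Rightarrow> 'v) \<Rightarrow>
     ('k, 'k \<times> 'v \<times> 'k) superalgebra" where
  "double_ext L B D =
     \<lparr> scl = (\<lambda>c (\<alpha>, X, \<beta>). (c * \<alpha>, scl L c X, c * \<beta>)),
       grade = (\<lambda>i. if i = 0 then {(\<alpha>, X, \<beta>). X \<in> grade L 0}
                    else {(\<alpha>, X, \<beta>). \<alpha> = 0 \<and> X \<in> grade L 1 \<and> \<beta> = 0}),
       brk = (\<lambda>(\<alpha>, X, \<beta>) (\<alpha>', X', \<beta>').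
                (0, brk L X X' + scl L \<alpha> (D X') - scl L \<alpha>' (D X), B (D X) X')) \<rparr>"

definition double_ext_form ::
    "('v \<Rightarrow> 'v \<Rightarrow> 'k::field) \<Rightarrow> 'k \<times> 'v \<times> 'k \<Rightarrow> 'k \<times> 'v \<times> 'k \<Rightarrow> 'k" where
  "double_ext_form B = (\<lambda>(\<alpha>, X, \<beta>) (\<alpha>', X', \<beta>'). B X X' + \<alpha> * \<beta>' + \<beta> * \<alpha>')"

section \<open>Superalgebras and forms given by tables on a basis\<close>

text \<open>\<open>p\<close> gives the degrees of the standard basis vectors of \<open>'k^'n\<close>, \<open>c\<close> their brackets and
  \<open>f\<close> the values of a form on them; the tables list both orders of each pair of arguments.\<close>

definition table_superalgebra ::
    "('n::finite \<Rightarrow> bit) \<Rightarrow> ('n \<Rightarrow> 'n \<Rightarrow> 'k::field ^ 'n) \<Rightarrow> ('k, 'k ^ 'n) superalgebra" where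
  "table_superalgebra p c =
     \<lparr> scl = (*s),
       grade = (\<lambda>d. {x. \<forall>i. p i \<noteq> d \<longrightarrow> x $ i = 0}),
       brk = (\<lambda>x y. \<Sum>i\<in>UNIV. \<Sum>j\<in>UNIV. (x $ i * y $ j) *s c i j) \<rparr>"

definition table_form :: "('n::finite \<Rightarrow> 'n \<Rightarrow> 'k::field) \<Rightarrow> 'k ^ 'n \<Rightarrow> 'k ^ 'n \<Rightarrow> 'k" where
  "table_form f x y = (\<Sum>i\<in>UNIV. \<Sum>j\<in>UNIV. x $ i * y $ j * f i j)"

definition bv :: "'n \<Rightarrow> complex ^ 'n" where
  "bv i = axis i 1"

definition matrix_unit :: "'n \<Rightarrow> 'n \<Rightarrow> complex ^ 'n ^ 'n" where
  "matrix_unit i j = (\<chi> r s. if r = i \<and> s = j then 1 else 0)"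

definition given_by_matrix ::
    "('k::field \<Rightarrow> 'v::ab_group_add \<Rightarrow> 'v) \<Rightarrow> ('n::finite \<Rightarrow> 'v) \<Rightarrow> 'k ^ 'n ^ 'n \<Rightarrow> ('v \<Rightarrow> 'v) \<Rightarrow> bool" where
  "given_by_matrix s u M T \<longleftrightarrow>
     Vector_Spaces.linear s s T \<and> (\<forall>j. T (u j) = (\<Sum>i\<in>UNIV. s (M $ i $ j) (u i)))"

lemma allbit: "(\<forall>i::bit. P i) \<longleftrightarrow> P 0 \<and> P 1"
  using bit.exhaust by metis

lemma table_linear_brk: "bilinear_map (*s) (*s) (brk (table_superalgebra p c))"
  unfolding bilinear_map_def table_superalgebra_def
  by (auto intro!: Vector_Spaces.linear.intro vec.vector_space_axioms module_hom.intro vec.module_axioms module_hom_axioms.intro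
    simp: Vector_Spaces.linear_def vec_eq_iff algebra_simps sum.distrib sum_distrib_left vec.module_axioms)

lemma vector_space_mult: "vector_space ((*) :: 'k::field \<Rightarrow> 'k \<Rightarrow> 'k)"
  by standard (auto simp: algebra_simps)
lemma table_linear_form: "bilinear_map (*s) (*) (table_form f)"
  unfolding bilinear_map_def table_form_def Vector_Spaces.linear_def
  by (auto intro!: vec.vector_space_axioms vector_space_mult module_hom.intro vec.module_axioms module_hom_axioms.intro
     simp: algebra_simps sum.distrib sum_distrib_left module_iff_vector_space vector_space_mult)

lemma table_graded: "graded_vector_space (table_superalgebra p c)"
  unfolding graded_vector_space_def table_superalgebra_def
  apply (auto simp: vec.vector_space_axioms vec.subspace_def vec_eq_iff)
  subgoal for x i by (cases "p i") auto
  subgoal for X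
    apply (rule exI[of _ "\<chi> i. if p i = 0 then X $ i else 0"])
    apply (simp)
    apply (rule exI[of _ "\<chi> i. if p i = 0 then 0 else X $ i"])
    by (auto simp: vec_eq_iff)
  done

lemma scl_table: "scl (table_superalgebra p c) = (*s)"
  by (simp add: table_superalgebra_def)

subsection \<open>The superalgebra \<open>\<gg>\<^sub>6\<^sub>,\<^sub>4\<close>\<close>

datatype basis6 = X0 | X1 | Y1 | Y2 | Y3 | Y4

lemma UNIV_basis6: "(UNIV :: basis6 set) = {X0, X1, Y1, Y2, Y3, Y4}"
  by (auto intro: basis6.exhaust)

instance basis6 :: finite
  by standard (simp add: UNIV_basis6)

fun deg6 :: "basis6 \<Rightarrow> bit" where
  "deg6 X0 = 0"
| "deg6 X1 = 0"
| "deg6 _ = 1"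

fun bracket6 :: "basis6 \<Rightarrow> basis6 \<Rightarrow> complex ^ basis6" where
  "bracket6 X1 Y1 = - bv Y2"
| "bracket6 Y1 X1 = bv Y2"
| "bracket6 X1 Y3 = bv Y4"
| "bracket6 Y3 X1 = - bv Y4"
| "bracket6 Y3 Y1 = bv X0"
| "bracket6 Y1 Y3 = bv X0"
| "bracket6 _ _ = 0"

fun form6 :: "basis6 \<Rightarrow> basis6 \<Rightarrow> complex" where
  "form6 X0 X1 = 1"
| "form6 X1 X0 = 1"
| "form6 Y4 Y1 = 1"
| "form6 Y1 Y4 = - 1"
| "form6 Y3 Y2 = 1"
| "form6 Y2 Y3 = - 1"
| "form6 _ _ = 0"

fun symp6 :: "complex \<Rightarrow> complex \<Rightarrow> complex \<Rightarrow> complex \<Rightarrow> complex \<Rightarrow> basis6 \<Rightarrow> basis6 \<Rightarrow> complex" where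
  "symp6 b1 b2 b4 c2 c3 X0 X1 = b1 + c3"
| "symp6 b1 b2 b4 c2 c3 X1 X0 = - (b1 + c3)"
| "symp6 b1 b2 b4 c2 c3 Y4 Y1 = - b1"
| "symp6 b1 b2 b4 c2 c3 Y1 Y4 = - b1"
| "symp6 b1 b2 b4 c2 c3 Y3 Y2 = c3"
| "symp6 b1 b2 b4 c2 c3 Y2 Y3 = c3"
| "symp6 b1 b2 b4 c2 c3 Y1 Y1 = b4"
| "symp6 b1 b2 b4 c2 c3 Y1 Y3 = - b2"
| "symp6 b1 b2 b4 c2 c3 Y3 Y1 = - b2"
| "symp6 b1 b2 b4 c2 c3 Y3 Y3 = - c2"
| "symp6 b1 b2 b4 c2 c3 _ _ = 0"

definition g64 :: "(complex, complex ^ basis6) superalgebra" where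
  "g64 = table_superalgebra deg6 bracket6"

definition B64 :: "complex ^ basis6 \<Rightarrow> complex ^ basis6 \<Rightarrow> complex" where
  "B64 = table_form form6"

definition omega64 ::
    "complex \<Rightarrow> complex \<Rightarrow> complex \<Rightarrow> complex \<Rightarrow> complex \<Rightarrow>
     complex ^ basis6 \<Rightarrow> complex ^ basis6 \<Rightarrow> complex" where
  "omega64 b1 b2 b4 c2 c3 = table_form (symp6 b1 b2 b4 c2 c3)"

lemma all6: "(\<forall>i. P i) \<longleftrightarrow> P X0 \<and> P X1 \<and> P Y1 \<and> P Y2 \<and> P Y3 \<and> P Y4"
  using basis6.exhaust by metis

lemma sum6: "(\<Sum>i\<in>UNIV. f i) = f X0 + f X1 + f Y1 + f Y2 + f Y3 + f Y4"
  for f :: "basis6 \<Rightarrow> 'a::comm_monoid_add"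
  by (simp add: UNIV_basis6 add.assoc)

lemma g64_lie: "lie_superalgebra g64"
  unfolding lie_superalgebra_def g64_def scl_table
  apply (intro conjI table_graded table_linear_brk)
  apply (simp_all add: table_superalgebra_def allbit all6 sum6 vec_eq_iff bv_def axis_def sg_def)
  done

lemma B64_inv: "invariant_scalar_product g64 B64"
  unfolding invariant_scalar_product_def even_form_def g64_def B64_def scl_table
  apply (intro conjI table_linear_form)
  apply (simp_all add: table_superalgebra_def table_form_def nondegenerate_form_def  allbit all6 sum6 vec_eq_iff bv_def axis_def sg_def)
  subgoal
    apply (intro conjI allI impI)
    subgoal for X by (drule spec[of _ "axis X1 1"]) (simp add: axis_def)
    subgoal for X by (drule spec[of _ "axis X0 1"]) (simp add: axis_def)
    subgoal for X by (drule spec[of _ "axis Y4 1"]) (simp add: axis_def)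
    subgoal for X by (drule spec[of _ "axis Y3 1"]) (simp add: axis_def)
    subgoal for X by (drule spec[of _ "axis Y2 1"]) (simp add: axis_def)
    subgoal for X by (drule spec[of _ "axis Y1 1"]) (simp add: axis_def)
    subgoal for X by (drule spec[of _ "axis X1 1"]) (simp add: axis_def)
    subgoal for X by (drule spec[of _ "axis X0 1"]) (simp add: axis_def)
    subgoal for X by (drule spec[of _ "axis Y4 1"]) (simp add: axis_def)
    subgoal for X by (drule spec[of _ "axis Y3 1"]) (simp add: axis_def)
    subgoal for X by (drule spec[of _ "axis Y2 1"]) (simp add: axis_def)
    subgoal for X by (drule spec[of _ "axis Y1 1"]) (simp add: axis_def)
    done
  apply (auto simp: algebra_simps)
  done

lemma omega_symp: assumes "b1 \<noteq> 0" "c3 \<noteq> 0" "b1 \<noteq> -c3"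
  shows "symplectic_structure g64 (omega64 b1 b2 b4 c2 c3)"
  unfolding symplectic_structure_def even_form_def g64_def omega64_def scl_table
  apply (intro conjI table_linear_form)
  apply (simp_all add: table_superalgebra_def table_form_def nondegenerate_form_def  allbit all6 sum6 vec_eq_iff bv_def axis_def sg_def)
  subgoal proof -
    have nz: "b1 + c3 \<noteq> 0" "- b1 \<noteq> c3" using assms by (auto simp: add_eq_0_iff2)
    have A: "X$X0 = 0 \<and> X$X1 = 0 \<and> X$Y1=0 \<and> X$Y2=0 \<and> X$Y3=0 \<and> X$Y4=0" 
      if H: "\<And>Y. table_form (symp6 b1 b2 b4 c2 c3) X Y = 0" for X
      using H[of "axis X0 1"] H[of "axis X1 1"] H[of "axis Y1 1"] H[of "axis Y2 1"] H[of "axis Y3 1"] H[of "axis Y4 1"]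
        nz assms by (simp add: table_form_def sum6 axis_def)
    have B: "X$X0 = 0 \<and> X$X1 = 0 \<and> X$Y1=0 \<and> X$Y2=0 \<and> X$Y3=0 \<and> X$Y4=0" 
      if H: "\<And>Y. table_form (symp6 b1 b2 b4 c2 c3) Y X = 0" for X
      using H[of "axis X0 1"] H[of "axis X1 1"] H[of "axis Y1 1"] H[of "axis Y2 1"] H[of "axis Y3 1"] H[of "axis Y4 1"]
        nz assms by (simp add: table_form_def sum6 axis_def)
    show ?thesis using A B unfolding table_form_def sum6 by simp
  qed
  apply (auto simp: algebra_simps)
  done

lemma g64_quadratic_symplectic:
  "quadratic_symplectic g64 B64 (omega64 b1 b2 b4 c2 c3)" if "b1 \<noteq> 0" "c3 \<noteq> 0" "b1 \<noteq> -c3"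
  using that by (simp add: quadratic_symplectic_def quadratic_def g64_lie B64_inv omega_symp)

subsection \<open>The eight-dimensional family\<close>

text \<open>The constructors are listed in the order of the basis
  \<open>(X\<^sub>0, X\<^sub>1, e, e\<^sup>*, Y\<^sub>1, Y\<^sub>2, Y\<^sub>3, Y\<^sub>4)\<close>.\<close>

datatype basis8 = FX0 | FX1 | Fe | Fes | FY1 | FY2 | FY3 | FY4

lemma UNIV_basis8: "(UNIV :: basis8 set) = {FX0, FX1, Fe, Fes, FY1, FY2, FY3, FY4}"
  by (auto intro: basis8.exhaust)

instance basis8 :: finite
  by standard (simp add: UNIV_basis8)

fun deg8 :: "basis8 \<Rightarrow> bit" where
  "deg8 FX0 = 0"
| "deg8 FX1 = 0"
| "deg8 Fe = 0"
| "deg8 Fes = 0"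
| "deg8 _ = 1"

fun bracket8 :: "complex \<Rightarrow> complex \<Rightarrow> complex \<Rightarrow> basis8 \<Rightarrow> basis8 \<Rightarrow> complex ^ basis8" where
  "bracket8 b2 b4 c2 Fe FY1 = b2 *s bv FY2 + b4 *s bv FY4"
| "bracket8 b2 b4 c2 FY1 Fe = - (b2 *s bv FY2 + b4 *s bv FY4)"
| "bracket8 b2 b4 c2 Fe FY3 = c2 *s bv FY2 - b2 *s bv FY4"
| "bracket8 b2 b4 c2 FY3 Fe = - (c2 *s bv FY2 - b2 *s bv FY4)"
| "bracket8 b2 b4 c2 FX1 FY1 = - bv FY2"
| "bracket8 b2 b4 c2 FY1 FX1 = bv FY2"
| "bracket8 b2 b4 c2 FX1 FY3 = bv FY4"
| "bracket8 b2 b4 c2 FY3 FX1 = - bv FY4"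
| "bracket8 b2 b4 c2 FY1 FY3 = bv FX0 - b2 *s bv Fes"
| "bracket8 b2 b4 c2 FY3 FY1 = bv FX0 - b2 *s bv Fes"
| "bracket8 b2 b4 c2 FY1 FY1 = b4 *s bv Fes"
| "bracket8 b2 b4 c2 FY3 FY3 = - (c2 *s bv Fes)"
| "bracket8 b2 b4 c2 _ _ = 0"

fun form8 :: "basis8 \<Rightarrow> basis8 \<Rightarrow> complex" where
  "form8 FX0 FX1 = 1"
| "form8 FX1 FX0 = 1"
| "form8 FY4 FY1 = 1"
| "form8 FY1 FY4 = - 1"
| "form8 FY3 FY2 = 1"
| "form8 FY2 FY3 = - 1"
| "form8 Fes Fe = 1"
| "form8 Fe Fes = 1"
| "form8 _ _ = 0"

definition g8 :: "complex \<Rightarrow> complex \<Rightarrow> complex \<Rightarrow> (complex, complex ^ basis8) superalgebra" where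
  "g8 b2 b4 c2 = table_superalgebra deg8 (bracket8 b2 b4 c2)"

definition B8 :: "complex ^ basis8 \<Rightarrow> complex ^ basis8 \<Rightarrow> complex" where
  "B8 = table_form form8"

definition delta_matrix :: "complex ^ basis8 ^ basis8" where
  "delta_matrix =
     2 *\<^sub>R matrix_unit FX0 FX0 - 2 *\<^sub>R matrix_unit FX1 FX1
     - 2 *\<^sub>R matrix_unit Fe Fe + 2 *\<^sub>R matrix_unit Fes Fes
     + matrix_unit FY1 FY1 - matrix_unit FY2 FY2
     + matrix_unit FY3 FY3 - matrix_unit FY4 FY4"

end

theory Submission
  imports Defs
begin

text \<open>Nilpotency kills the eigenvalues of \<open>D\<close> on \<open>X\<^sub>0, Y\<^sub>2, Y\<^sub>4\<close>, which leaves
  \<open>D(Y\<^sub>1) = b\<^sub>2 Y\<^sub>2 + b\<^sub>4 Y\<^sub>4\<close>, \<open>D(Y\<^sub>3) = c\<^sub>2 Y\<^sub>2 - b\<^sub>2 Y\<^sub>4\<close> and \<open>D = 0\<close> on the other basis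
  vectors.  Since \<open>ad X\<^sub>1\<close> is such a map with \<open>(b\<^sub>2, b\<^sub>4, c\<^sub>2) = (-1, 0, 0)\<close>, replacing \<open>e\<close> by
  \<open>e + t X\<^sub>1\<close> shifts \<open>b\<^sub>2\<close> at will, so \<open>b\<^sub>2 = 1\<close> can always be reached, in particular when \<open>D = 0\<close>.
  The matrix is the derivation of a grading of the eight-dimensional algebra in which the
  scalar product pairs opposite degrees; it is transported along the isomorphism.\<close>

section \<open>The eight-dimensional algebras and their scalar product\<close>

lemma bv_nth: "bv i $ j = (if j = i then 1 else 0)"
  by (simp add: bv_def axis_def)

lemma all8: "(\<forall>i. P i) \<longleftrightarrow>
    P FX0 \<and> P FX1 \<and> P Fe \<and> P Fes \<and> P FY1 \<and> P FY2 \<and> P FY3 \<and> P FY4"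
  using basis8.exhaust by metis

lemma sum8: "(\<Sum>i\<in>UNIV. f i) = f FX0 + f FX1 + f Fe + f Fes + f FY1 + f FY2 + f FY3 + f FY4"
  for f :: "basis8 \<Rightarrow> 'a::comm_monoid_add"
  by (simp add: UNIV_basis8 add.assoc)

text \<open>All brackets lie in the span of \<open>FX0\<close>, \<open>Fes\<close>,
  \<open>FY2\<close>, \<open>FY4\<close>, and these basis vectors are central. The algebra is thus
  two-step nilpotent and each term of the Jacobi identity vanishes by itself, whatever the
  parameters.\<close>

lemma g8_lie: "lie_superalgebra (g8 b2 b4 c2)"
  unfolding lie_superalgebra_def g8_def scl_table
  apply (intro conjI table_graded table_linear_brk)
    apply (simp_all add: table_superalgebra_def allbit all8 sum8 vec_eq_iff bv_nth sg_def)
  done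

lemma B8_nth:
  "B8 X (bv FX0) = X $ FX1" "B8 X (bv FX1) = X $ FX0"
  "B8 X (bv Fe) = X $ Fes" "B8 X (bv Fes) = X $ Fe"
  "B8 X (bv FY1) = X $ FY4" "B8 X (bv FY4) = - X $ FY1"
  "B8 X (bv FY2) = X $ FY3" "B8 X (bv FY3) = - X $ FY2"
  "B8 (bv FX0) X = X $ FX1" "B8 (bv FX1) X = X $ FX0"
  "B8 (bv Fe) X = X $ Fes" "B8 (bv Fes) X = X $ Fe"
  "B8 (bv FY1) X = - X $ FY4" "B8 (bv FY4) X = X $ FY1"
  "B8 (bv FY2) X = - X $ FY3" "B8 (bv FY3) X = X $ FY2"
  by (simp_all add: B8_def table_form_def sum8 bv_nth)

text \<open>The standard basis is its own dual basis up to order and sign, so pairing with the eight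
  basis vectors on either side recovers every coordinate.\<close>

lemma B8_nondegenerate: "nondegenerate_form B8"
proof -
  have "X = 0" if "\<forall>i. B8 X (bv i) = 0" for X
    using that unfolding all8 B8_nth by (simp add: vec_eq_iff all8)
  moreover have "X = 0" if "\<forall>i. B8 (bv i) X = 0" for X
    using that unfolding all8 B8_nth by (simp add: vec_eq_iff all8)
  ultimately show ?thesis unfolding nondegenerate_form_def by blast
qed

lemma B8_inv: "invariant_scalar_product (g8 b2 b4 c2) B8"
  unfolding invariant_scalar_product_def even_form_def
  apply (intro conjI B8_nondegenerate)
  subgoal by (simp add: g8_def scl_table B8_def table_linear_form)
    apply (simp_all add: g8_def B8_def table_superalgebra_def table_form_def allbit all8 sum8
      vec_eq_iff bv_nth sg_def)
  apply (auto simp: algebra_simps)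
  done

lemma g8_quadratic: "quadratic (g8 b2 b4 c2) B8"
  by (simp add: quadratic_def g8_lie B8_inv)

section \<open>Linear maps and the transport of quadratic structures\<close>

lemma linear_homs:
  assumes "Vector_Spaces.linear s t f"
  shows "f (x + y) = f x + f y" "f (- x) = - f x" "f 0 = 0" "f (s c x) = t c (f x)"
proof -
  interpret Vector_Spaces.linear s t f by fact
  show "f (x + y) = f x + f y" "f (- x) = - f x" "f 0 = 0" "f (s c x) = t c (f x)"
    by (simp_all add: add neg scale)
qed

lemma linearI:
  assumes "vector_space s" "vector_space t" "\<And>x y. f (x + y) = f x + f y"
    "\<And>c x. f (s c x) = t c (f x)"
  shows "Vector_Spaces.linear s t f"
  unfolding Vector_Spaces.linear_def module_hom_def module_hom_axioms_def
  using assms by (simp add: module_iff_vector_space)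

lemma bilinear_map_pullback:
  assumes \<phi>: "Vector_Spaces.linear s s' \<phi>" and f': "bilinear_map s' t f'"
    and f: "\<And>X Y. f' (\<phi> X) (\<phi> Y) = f X Y"
  shows "bilinear_map s t f"
proof -
  have "Vector_Spaces.linear s t (\<lambda>Y. f' (\<phi> X) (\<phi> Y))"
       "Vector_Spaces.linear s t (\<lambda>Y. f' (\<phi> Y) (\<phi> X))" for X
    using f' Vector_Spaces.linear_compose[OF \<phi>] unfolding bilinear_map_def comp_def by blast+
  then show ?thesis by (simp add: bilinear_map_def f)
qed

text \<open>Each linearity equation is checked after applying \<open>\<phi>\<close>, where it is
  inherited from \<open>f'\<close>; injectivity removes \<open>\<phi>\<close> again.\<close>

lemma bilinear_map_pullback_algebra:
  assumes \<phi>: "Vector_Spaces.linear s s' \<phi>" and "inj \<phi>" and f': "bilinear_map s' s' f'"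
    and f: "\<And>X Y. \<phi> (f X Y) = f' (\<phi> X) (\<phi> Y)"
  shows "bilinear_map s s f"
proof -
  have "vector_space s" using \<phi> by (simp add: Vector_Spaces.linear_def)
  have R: "Vector_Spaces.linear s' s' (\<lambda>Y. f' X Y)" and L: "Vector_Spaces.linear s' s' (\<lambda>Y. f' Y X)" for X
    using f' by (simp_all add: bilinear_map_def)
  have "\<phi> (f X (Y + Z)) = \<phi> (f X Y + f X Z)" "\<phi> (f (Y + Z) X) = \<phi> (f Y X + f Z X)"
    "\<phi> (f X (s c Y)) = \<phi> (s c (f X Y))" "\<phi> (f (s c Y) X) = \<phi> (s c (f Y X))" for X Y Z c
    by (simp_all add: f linear_homs[OF \<phi>] linear_homs[OF R] linear_homs[OF L])
  then have "f X (Y + Z) = f X Y + f X Z" "f (Y + Z) X = f Y X + f Z X"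
    "f X (s c Y) = s c (f X Y)" "f (s c Y) X = s c (f Y X)" for X Y Z c
    using \<open>inj \<phi>\<close> by (blast dest: injD)+
  then show ?thesis
    unfolding bilinear_map_def by (intro conjI allI linearI \<open>vector_space s\<close>)
qed

text \<open>Serves to obtain the axioms for a double extension from those of \<open>g8\<close>, so
  that they need no direct verification.\<close>

lemma quadratic_pullback:
  assumes \<phi>: "Vector_Spaces.linear (scl L) (scl L') \<phi>" and bij: "bij \<phi>"
    and gr: "\<And>i. \<phi> ` grade L i = grade L' i"
    and brk: "\<And>X Y. \<phi> (brk L X Y) = brk L' (\<phi> X) (\<phi> Y)"
    and B: "\<And>X Y. B' (\<phi> X) (\<phi> Y) = B X Y"
    and Q: "quadratic L' B'"
  shows "quadratic L B"
proof -
  note homs = linear_homs[OF \<phi>]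
  \<comment> \<open>Equality, degree and vanishing in \<open>L\<close> are restated as facts about
    images under \<open>\<phi>\<close>. Rewriting with these turns every axiom of \<open>L\<close>
    into the same axiom of \<open>L'\<close>.\<close>
  have inj: "\<phi> X = \<phi> Y \<longleftrightarrow> X = Y" for X Y using bij by (simp add: bij_def inj_eq)
  have grade: "X \<in> grade L i \<longleftrightarrow> \<phi> X \<in> grade L' i" for X i
    using gr[of i] inj by (metis image_iff)
  have zero: "X = 0 \<longleftrightarrow> \<phi> X = 0" for X using inj[of X 0] by (simp add: homs)
  have surj: "\<exists>X. \<phi> X = Y" for Y using bij by (metis bij_pointE)
  have vs: "vector_space (scl L)" using \<phi> by (simp add: Vector_Spaces.linear_def)
  have lie': "lie_superalgebra L'" and inv': "invariant_scalar_product L' B'"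
    using Q by (simp_all add: quadratic_def)
  have gv': "graded_vector_space L'" using lie' by (simp add: lie_superalgebra_def)
  have "module.subspace (scl L) (grade L i)" for i
  proof -
    have "module.subspace (scl L') (grade L' i)" "vector_space (scl L')"
      using gv' by (simp_all add: graded_vector_space_def)
    then show ?thesis
      using vs by (simp add: module.subspace_def module_iff_vector_space grade homs)
  qed
  moreover have "grade L 0 \<inter> grade L 1 = {0}"
  proof -
    have "grade L' 0 \<inter> grade L' 1 = {0}" using gv' by (simp add: graded_vector_space_def)
    then show ?thesis by (auto simp: grade set_eq_iff zero)
  qed
  moreover have "\<exists>U \<in> grade L 0. \<exists>V \<in> grade L 1. X = U + V" for X
  proof -
    obtain U V where "U \<in> grade L' 0" "V \<in> grade L' 1" "\<phi> X = U + V"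
      using gv' unfolding graded_vector_space_def by blast
    moreover obtain U' V' where "\<phi> U' = U" "\<phi> V' = V" using surj by metis
    ultimately show ?thesis
      by (intro bexI[of _ U'] bexI[of _ V']) (auto simp: grade homs inj[symmetric])
  qed
  ultimately have "graded_vector_space L"
    using vs by (simp add: graded_vector_space_def)
  moreover have "bilinear_map (scl L) (scl L) (brk L)"
    using bilinear_map_pullback_algebra[of "scl L" "scl L'" \<phi> "brk L'" "brk L"] \<phi> brk bij lie'
    by (simp add: bij_def lie_superalgebra_def)
  moreover have "brk L X Y \<in> grade L (x + y)" if "X \<in> grade L x" "Y \<in> grade L y" for X Y x y
    using lie' that unfolding lie_superalgebra_def grade brk by blast
  moreover have "brk L X Y = - scl L (sg (x * y)) (brk L Y X)"
    if "X \<in> grade L x" "Y \<in> grade L y" for X Y x y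
    using lie' that unfolding lie_superalgebra_def grade inj[symmetric] homs brk by blast
  moreover have "scl L (sg (x * z)) (brk L X (brk L Y Z)) +
        scl L (sg (x * y)) (brk L Y (brk L Z X)) +
        scl L (sg (y * z)) (brk L Z (brk L X Y)) = 0"
    if "X \<in> grade L x" "Y \<in> grade L y" "Z \<in> grade L z" for X Y Z x y z
    using lie' that unfolding lie_superalgebra_def grade inj[symmetric] homs brk by blast
  ultimately have "lie_superalgebra L"
    unfolding lie_superalgebra_def by blast
  moreover have "bilinear_map (scl L) (*) B"
    using bilinear_map_pullback[of _ _ _ _ B', OF \<phi> _ B] inv'
    by (simp add: invariant_scalar_product_def even_form_def)
  moreover have "nondegenerate_form B"
    using inv' surj unfolding invariant_scalar_product_def nondegenerate_form_def B[symmetric] zero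
    by metis
  ultimately show ?thesis
    using inv' unfolding quadratic_def invariant_scalar_product_def even_form_def
      Ball_def grade B[symmetric] brk by blast
qed

section \<open>From invertible superderivations to symplectic structures\<close>

text \<open>Skew-supersymmetry of \<open>\<delta>\<close> combined with supersymmetry of
  \<open>B\<close> gives skew-supersymmetry of the new form, bijectivity gives non-degeneracy, and
  the derivation rule gives the cyclic identity.\<close>

lemma symplectic_of_superderivation:
  assumes Q: "quadratic L B" and \<delta>: "even_superderivation L \<delta>" and "bij \<delta>"
    and skew: "skew_supersymmetric B \<delta>"
  shows "quadratic_symplectic L B (\<lambda>X Y. B (\<delta> X) Y)"
proof -
  have lin: "Vector_Spaces.linear (scl L) (scl L) \<delta>"
    and der: "\<And>X Y. \<delta> (brk L X Y) = brk L (\<delta> X) Y + brk L X (\<delta> Y)"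
    and ev: "\<And>X i. X \<in> grade L i \<Longrightarrow> \<delta> X \<in> grade L i"
    using \<delta> by (auto simp: even_superderivation_def)
  have sk: "\<And>X Y. B (\<delta> X) Y = - B X (\<delta> Y)" using skew by (simp add: skew_supersymmetric_def)
  have bil: "bilinear_map (scl L) (*) B" and evB: "\<And>X Y. X \<in> grade L 0 \<Longrightarrow> Y \<in> grade L 1 \<Longrightarrow> B X Y = 0 \<and> B Y X = 0"
    and nd: "nondegenerate_form B"
    and sym: "\<And>X Y x y. X \<in> grade L x \<Longrightarrow> Y \<in> grade L y \<Longrightarrow> B X Y = sg (x * y) * B Y X"
    and inv: "\<And>X Y Z. B (brk L X Y) Z = B X (brk L Y Z)"
    using Q unfolding quadratic_def invariant_scalar_product_def even_form_def by blast+
  have gr: "\<And>X Y x y. X \<in> grade L x \<Longrightarrow> Y \<in> grade L y \<Longrightarrow> brk L X Y \<in> grade L (x + y)"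
    using Q unfolding quadratic_def lie_superalgebra_def by blast
  have linR: "Vector_Spaces.linear (scl L) (*) (\<lambda>Y. B X Y)" for X
    using bil by (simp add: bilinear_map_def)
  have linL: "Vector_Spaces.linear (scl L) (*) (\<lambda>X. B X Y)" for Y
    using bil by (simp add: bilinear_map_def)
  note BR = linear_homs[OF linR] and BL = linear_homs[OF linL]
  have "bilinear_map (scl L) (*) (\<lambda>X Y. B (\<delta> X) Y)"
    unfolding bilinear_map_def
    using linR Vector_Spaces.linear_compose[OF lin linL] by (auto simp: comp_def)
  moreover have "nondegenerate_form (\<lambda>X Y. B (\<delta> X) Y)"
  proof -
    have "\<delta> X = 0 \<Longrightarrow> X = 0" for X
      using \<open>bij \<delta>\<close> linear_homs(3)[OF lin] by (metis bij_pointE)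
    then show ?thesis
      using nd \<open>bij \<delta>\<close> unfolding nondegenerate_form_def by (metis bij_pointE)
  qed
  moreover have "B (\<delta> X) Y = - sg (x * y) * B (\<delta> Y) X" if "X \<in> grade L x" "Y \<in> grade L y" for X Y x y
    using sk[of X Y] sym[OF that(1) ev[OF that(2)]] by simp
  moreover have "sg (x * z) * B (\<delta> X) (brk L Y Z) + sg (y * x) * B (\<delta> Y) (brk L Z X) +
        sg (z * y) * B (\<delta> Z) (brk L X Y) = 0"
    if h: "X \<in> grade L x" "Y \<in> grade L y" "Z \<in> grade L z" for X Y Z x y z
  proof -
    \<comment> \<open>Skew-supersymmetry moves \<open>\<delta>\<close> off \<open>X\<close> and the
      derivation rule splits the result in two. By invariance and supersymmetry these pieces are, up
      to sign, the values in the other two cyclic terms; the signs cancel in all eight parity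
      cases.\<close>
    have 1: "B (\<delta> X) (brk L Y Z) = - B X (brk L (\<delta> Y) Z) - B X (brk L Y (\<delta> Z))"
      using sk[of X "brk L Y Z"] by (simp add: der BR)
    have 2: "B X (brk L Y (\<delta> Z)) = sg ((x + y) * z) * B (\<delta> Z) (brk L X Y)"
      using sym[OF gr[OF h(1,2)] ev[OF h(3)]] by (simp only: inv)
    have 3: "B X (brk L (\<delta> Y) Z) = sg (x * (y + z)) * B (\<delta> Y) (brk L Z X)"
      using sym[OF h(1) gr[OF ev[OF h(2)] h(3)]] by (simp add: inv)
    show ?thesis unfolding 1 2 3
      by (cases x; cases y; cases z) (simp_all add: sg_def)
  qed
  ultimately show ?thesis
    using Q evB ev unfolding quadratic_symplectic_def symplectic_structure_def even_form_def by blast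
qed

section \<open>Nilpotent skew-supersymmetric superderivations of \<open>g64\<close>\<close>

text \<open>The powers of \<open>D\<close> act on \<open>v\<close> by the powers of
  \<open>c\<close>, and one of them is zero.\<close>

lemma nilpotent_eigenvalue:
  assumes D: "Vector_Spaces.linear s s D" and nil: "nilpotent_map D"
    and v: "D v = s c v" "v \<noteq> 0"
  shows "c = 0"
proof -
  interpret Vector_Spaces.linear s s D by fact
  have pow: "(D ^^ n) v = s (c ^ n) v" for n
    by (induction n) (simp_all add: v scale mult.commute)
  obtain n where "(D ^^ n) v = 0" using nil by (auto simp: nilpotent_map_def)
  then show ?thesis using v(2) by (simp add: pow)
qed

lemma B64_nth:
  "B64 X (bv X0) = X $ X1" "B64 X (bv X1) = X $ X0"
  "B64 X (bv Y1) = X $ Y4" "B64 X (bv Y4) = - X $ Y1"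
  "B64 X (bv Y2) = X $ Y3" "B64 X (bv Y3) = - X $ Y2"
  "B64 (bv X0) X = X $ X1" "B64 (bv X1) X = X $ X0"
  "B64 (bv Y1) X = - X $ Y4" "B64 (bv Y4) X = X $ Y1"
  "B64 (bv Y2) X = - X $ Y3" "B64 (bv Y3) X = X $ Y2"
  by (simp_all add: B64_def table_form_def sum6 bv_nth)

lemma brk_g64:
  "brk g64 X Y = (X $ Y1 * Y $ Y3 + X $ Y3 * Y $ Y1) *s bv X0
     + (X $ Y1 * Y $ X1 - X $ X1 * Y $ Y1) *s bv Y2
     + (X $ X1 * Y $ Y3 - X $ Y3 * Y $ X1) *s bv Y4"
  by (simp add: g64_def table_superalgebra_def sum6 vec_eq_iff all6 bv_nth)

lemma scl_g64: "scl g64 = (*s)"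
  by (simp add: g64_def scl_table)

lemma vec_basis6: "X = (\<Sum>i\<in>UNIV. X $ i *s bv i)" for X :: "complex ^ basis6"
  by (simp add: sum6 vec_eq_iff all6 bv_nth)

text \<open>Normal form of the superderivations to be extended by. The parameter \<open>b2\<close>
  enters twice because skew-supersymmetry ties the \<open>Y2\<close> coordinate of the image of
  \<open>Y1\<close> to the \<open>Y4\<close> coordinate of the image of \<open>Y3\<close>.\<close>

definition der6 :: "complex \<Rightarrow> complex \<Rightarrow> complex \<Rightarrow> complex ^ basis6 \<Rightarrow> complex ^ basis6" where
  "der6 b2 b4 c2 X = (b2 * X $ Y1 + c2 * X $ Y3) *s bv Y2 + (b4 * X $ Y1 - b2 * X $ Y3) *s bv Y4"

lemma nilpotent_superderivation_g64:
  assumes der: "even_superderivation g64 D" and skew: "skew_supersymmetric B64 D"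
    and nil: "nilpotent_map D"
  obtains b2 b4 c2 where "D = der6 b2 b4 c2"
proof -
  have lin: "Vector_Spaces.linear (*s) (*s) D"
    using der by (simp add: even_superderivation_def g64_def scl_table)
  note hom = linear_homs[OF lin]
  have gr: "D (bv j) $ i = 0" if "deg6 i \<noteq> deg6 j" for i j
  proof -
    have "bv j \<in> grade g64 (deg6 j)"
      by (auto simp: g64_def table_superalgebra_def bv_nth)
    then have "D (bv j) \<in> grade g64 (deg6 j)"
      using der unfolding even_superderivation_def by blast
    then show ?thesis
      using that by (simp add: g64_def table_superalgebra_def)
  qed
  have ev: "D (bv X0) $ Y1 = 0" "D (bv X0) $ Y2 = 0" "D (bv X0) $ Y3 = 0" "D (bv X0) $ Y4 = 0"
    "D (bv X1) $ Y1 = 0" "D (bv X1) $ Y2 = 0" "D (bv X1) $ Y3 = 0" "D (bv X1) $ Y4 = 0"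
    "D (bv Y1) $ X0 = 0" "D (bv Y1) $ X1 = 0" "D (bv Y3) $ X0 = 0" "D (bv Y3) $ X1 = 0"
    by (simp_all add: gr)
  have sk: "B64 (D X) Y = - B64 X (D Y)" for X Y
    using skew by (simp add: skew_supersymmetric_def)
  \<comment> \<open>Skew-supersymmetry on the pairs X0,X0 and X1,X1 says that a coordinate equals
    its own negative; the pairs X1,X0 and Y1,Y3 link two coordinates each.\<close>
  have s: "D (bv X0) $ X1 = 0" "D (bv X1) $ X0 = 0" "D (bv X1) $ X1 = - D (bv X0) $ X0"
    "D (bv Y3) $ Y4 = - D (bv Y1) $ Y2"
    using sk[of "bv X0" "bv X0"] sk[of "bv X1" "bv X1"] sk[of "bv X1" "bv X0"]
      sk[of "bv Y1" "bv Y3"]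
    by (simp_all add: B64_nth)
  have lb: "D (brk g64 X Y) = brk g64 (D X) Y + brk g64 X (D Y)" for X Y
    using der by (simp add: even_superderivation_def)
  have br: "brk g64 (bv X1) (bv Y1) = - bv Y2" "brk g64 (bv X1) (bv Y3) = bv Y4"
    "brk g64 (bv Y1) (bv Y3) = bv X0" "brk g64 (bv Y1) (bv Y1) = 0" "brk g64 (bv Y3) (bv Y3) = 0"
    by (simp_all add: brk_g64 vec_eq_iff bv_nth)
  \<comment> \<open>\<open>Y1\<close> and \<open>Y3\<close> have zero square, so the derivation rule
    makes twice the off-diagonal coordinate vanish.\<close>
  have off: "D (bv Y1) $ Y3 = 0" "D (bv Y3) $ Y1 = 0"
    using lb[of "bv Y1" "bv Y1"] lb[of "bv Y3" "bv Y3"]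
    by (simp_all add: br hom brk_g64 vec_eq_iff all6 bv_nth)
  note simps = br hom brk_g64 vec_eq_iff all6 bv_nth s off ev
  have "D (bv X0) = D (bv X0) $ X0 *s bv X0"
    by (simp add: simps gr)
  \<comment> \<open>\<open>Y2\<close>, \<open>Y4\<close> and \<open>X0\<close> are brackets up to
    sign, so the derivation rule makes them eigenvectors. With a and c the diagonal coordinates at
    \<open>Y1\<close> and \<open>Y3\<close>, the eigenvalues are -c, -a and a + c.\<close>
  moreover have "D (bv Y2) = - D (bv Y3) $ Y3 *s bv Y2" "D (bv Y4) = - D (bv Y1) $ Y1 *s bv Y4"
    "D (bv X0) $ X0 = D (bv Y1) $ Y1 + D (bv Y3) $ Y3"
    using lb[of "bv X1" "bv Y1"] lb[of "bv X1" "bv Y3"] lb[of "bv Y1" "bv Y3"]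
    by (auto simp: simps algebra_simps eq_neg_iff_add_eq_0) algebra
  moreover have "bv i \<noteq> 0" for i :: basis6
    by (auto simp: vec_eq_iff bv_nth)
  \<comment> \<open>Nilpotency forces -c = -a = a + c = 0.\<close>
  ultimately have z: "D (bv Y1) $ Y1 = 0" "D (bv Y3) $ Y3 = 0" "D (bv X0) $ X0 = 0"
    and D0: "D (bv X0) = 0" "D (bv Y2) = 0" "D (bv Y4) = 0"
    using nilpotent_eigenvalue[OF lin nil, of "bv X0" "D (bv X0) $ X0"]
      nilpotent_eigenvalue[OF lin nil, of "bv Y2" "- D (bv Y3) $ Y3"]
      nilpotent_eigenvalue[OF lin nil, of "bv Y4" "- D (bv Y1) $ Y1"]
    by simp_all
  have D1: "D (bv X1) = 0" by (simp add: simps z)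
  have "D X = der6 (D (bv Y1) $ Y2) (D (bv Y1) $ Y4) (D (bv Y3) $ Y2) X" for X
  proof -
    \<comment> \<open>Of the images of the six basis vectors only those of \<open>Y1\<close> and
      \<open>Y3\<close> can be nonzero.\<close>
    have "D X = X $ Y1 *s D (bv Y1) + X $ Y3 *s D (bv Y3)"
      by (subst vec_basis6) (simp add: sum6 hom D0 D1)
    then show ?thesis
      by (simp add: der6_def vec_eq_iff all6 bv_nth s off ev z algebra_simps)
  qed
  then show ?thesis using that by blast
qed

section \<open>The isomorphism from the double extension onto \<open>g8\<close>\<close>

fun ext_coord8 :: "complex \<Rightarrow> complex \<times> (complex ^ basis6) \<times> complex \<Rightarrow> basis8 \<Rightarrow> complex" where
  "ext_coord8 t (\<alpha>, X, \<beta>) FX0 = X $ X0"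
| "ext_coord8 t (\<alpha>, X, \<beta>) FX1 = X $ X1 + t * \<alpha>"
| "ext_coord8 t (\<alpha>, X, \<beta>) Fe = \<alpha>"
| "ext_coord8 t (\<alpha>, X, \<beta>) Fes = \<beta> - t * X $ X0"
| "ext_coord8 t (\<alpha>, X, \<beta>) FY1 = X $ Y1"
| "ext_coord8 t (\<alpha>, X, \<beta>) FY2 = X $ Y2"
| "ext_coord8 t (\<alpha>, X, \<beta>) FY3 = X $ Y3"
| "ext_coord8 t (\<alpha>, X, \<beta>) FY4 = X $ Y4"

text \<open>Sends \<open>e\<close> to \<open>e + t X\<^sub>1\<close> and \<open>X\<^sub>0\<close> to \<open>X\<^sub>0 - t e\<^sup>*\<close>, the latter to preserve the scalar product.\<close>

definition ext_to_g8 :: "complex \<Rightarrow> complex \<times> (complex ^ basis6) \<times> complex \<Rightarrow> complex ^ basis8" where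
  "ext_to_g8 t Z = (\<chi> i. ext_coord8 t Z i)"

lemma ext_to_g8_nth: "ext_to_g8 t Z $ i = ext_coord8 t Z i"
  by (simp add: ext_to_g8_def)

text \<open>The middle component of the inverse of \<open>ext_to_g8 t\<close>, needed as a witness
  of bijectivity.\<close>

fun vec6_of_8 :: "complex \<Rightarrow> complex ^ basis8 \<Rightarrow> basis6 \<Rightarrow> complex" where
  "vec6_of_8 t Z X0 = Z $ FX0"
| "vec6_of_8 t Z X1 = Z $ FX1 - t * Z $ Fe"
| "vec6_of_8 t Z Y1 = Z $ FY1"
| "vec6_of_8 t Z Y2 = Z $ FY2"
| "vec6_of_8 t Z Y3 = Z $ FY3"
| "vec6_of_8 t Z Y4 = Z $ FY4"

lemma bij_ext_to_g8: "bij (ext_to_g8 t)"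
  by (rule bij_betw_byWitness[where f' = "\<lambda>Z. (Z $ Fe, \<chi> i. vec6_of_8 t Z i, Z $ Fes + t * Z $ FX0)"])
    (auto simp: vec_eq_iff all6 all8 ext_to_g8_nth)

lemma vector_space_double_ext:
  assumes "vector_space (scl L)"
  shows "vector_space (scl (double_ext L B D))"
proof -
  interpret vector_space "scl L" by fact
  show ?thesis
    by standard (auto simp: double_ext_def algebra_simps scale_right_distrib scale_left_distrib)
qed

lemma linear_ext_to_g8:
  "Vector_Spaces.linear (scl (double_ext g64 B64 D)) (scl (g8 b2 b4 c2)) (ext_to_g8 t)"
proof (rule linearI)
  show "vector_space (scl (double_ext g64 B64 D))"
    by (rule vector_space_double_ext) (simp add: g64_def scl_table vec.vector_space_axioms)
  show "vector_space (scl (g8 b2 b4 c2))"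
    by (simp add: g8_def scl_table vec.vector_space_axioms)
qed (auto simp: vec_eq_iff all8 ext_to_g8_nth double_ext_def g64_def g8_def scl_table algebra_simps)

text \<open>The two shifts cancel: what the \<open>FX1\<close> coordinate gains is paired with the
  \<open>FX0\<close> coordinate, and what the \<open>Fes\<close> coordinate loses is paired with the
  \<open>Fe\<close> coordinate.\<close>

lemma ext_to_g8_form: "B8 (ext_to_g8 t X) (ext_to_g8 t Y) = double_ext_form B64 X Y"
  by (cases X; cases Y)
    (simp add: double_ext_form_def B8_def B64_def table_form_def sum6 sum8 ext_to_g8_nth algebra_simps)

lemma brk_g8:
  "brk (g8 b2 b4 c2) X Y =
     (X $ FY1 * Y $ FY3 + X $ FY3 * Y $ FY1) *s (bv FX0 - b2 *s bv Fes)
     + (b4 * X $ FY1 * Y $ FY1 - c2 * X $ FY3 * Y $ FY3) *s bv Fes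
     + (X $ FY1 * Y $ FX1 - X $ FX1 * Y $ FY1) *s bv FY2
     + (X $ FX1 * Y $ FY3 - X $ FY3 * Y $ FX1) *s bv FY4
     + (X $ Fe * Y $ FY1 - X $ FY1 * Y $ Fe) *s (b2 *s bv FY2 + b4 *s bv FY4)
     + (X $ Fe * Y $ FY3 - X $ FY3 * Y $ Fe) *s (c2 *s bv FY2 - b2 *s bv FY4)"
  by (simp add: g8_def table_superalgebra_def sum8 vec_eq_iff all8 bv_nth algebra_simps)

text \<open>In \<open>g8\<close> the image of e acts on the odd part as
  \<open>der6 (d2 + t) b4 c2\<close> plus \<open>t\<close> times ad X1, that is as
  \<open>der6 d2 b4 c2\<close>. In the product of \<open>Y1\<close> and \<open>Y3\<close> the image
  of X0 contributes -t to the \<open>Fes\<close> coordinate, which turns -d2 into -(d2 + t).\<close>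

lemma ext_to_g8_brk:
  "ext_to_g8 t (brk (double_ext g64 B64 (der6 d2 b4 c2)) X Y) =
     brk (g8 (d2 + t) b4 c2) (ext_to_g8 t X) (ext_to_g8 t Y)"
  by (cases X; cases Y)
    (simp add: double_ext_def brk_g64 brk_g8 der6_def vec_eq_iff all8 ext_to_g8_nth bv_nth
      B64_def table_form_def sum6 scl_g64 algebra_simps)

lemma ext_to_g8_grade:
  "ext_to_g8 t ` grade (double_ext g64 B64 D) i = grade (g8 b2 b4 c2) i"
proof -
  have "ext_to_g8 t Z \<in> grade (g8 b2 b4 c2) i \<longleftrightarrow> Z \<in> grade (double_ext g64 B64 D) i" for Z
    by (cases Z; cases i)
      (auto simp: double_ext_def g8_def g64_def table_superalgebra_def all6 all8 ext_to_g8_nth)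
  \<comment> \<open>The pointwise equivalence identifies a preimage; surjectivity turns this into
    the claim about the image.\<close>
  then have "grade (double_ext g64 B64 D) i = ext_to_g8 t -` grade (g8 b2 b4 c2) i" by auto
  then show ?thesis using bij_ext_to_g8[of t] by (simp add: bij_def)
qed

lemma ext_to_g8_i_isomorphism:
  "i_isomorphism (double_ext g64 B64 (der6 d2 b4 c2)) (double_ext_form B64)
     (g8 (d2 + t) b4 c2) B8 (ext_to_g8 t)"
    (is "i_isomorphism ?L ?B ?L' B8 ?\<phi>")
proof -
  note iso = linear_ext_to_g8 bij_ext_to_g8 ext_to_g8_grade ext_to_g8_brk ext_to_g8_form
  have Q: "quadratic ?L ?B"
    by (rule quadratic_pullback[where L' = ?L' and B' = B8 and \<phi> = ?\<phi>]) (fact iso g8_quadratic)+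
  show ?thesis
    unfolding i_isomorphism_def by (intro conjI allI) (fact iso Q g8_quadratic)+
qed

section \<open>Conjugation of endomorphisms by an isomorphism\<close>

lemma linear_inv:
  assumes \<phi>: "Vector_Spaces.linear s t \<phi>" and "bij \<phi>"
  shows "Vector_Spaces.linear t s (inv \<phi>)"
proof (rule linearI)
  show "vector_space t" "vector_space s" using \<phi> by (simp_all add: Vector_Spaces.linear_def)
  have inj: "inj \<phi>" and [simp]: "\<phi> (inv \<phi> y) = y" for y
    using \<open>bij \<phi>\<close> by (simp_all add: bij_def surj_f_inv_f)
  show "inv \<phi> (x + y) = inv \<phi> x + inv \<phi> y" "inv \<phi> (t c x) = s c (inv \<phi> x)" for x y c
    by (rule injD[OF inj], simp add: linear_homs[OF \<phi>])+
qed

text \<open>The chosen basis is the \<open>\<phi>\<close>-preimage of the standard one, so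
  conjugation by \<open>\<phi>\<close> leaves the matrix entries unchanged.\<close>

lemma given_by_matrix_conjugate:
  fixes \<phi> :: "'v::ab_group_add \<Rightarrow> complex ^ 'n"
  assumes \<phi>: "Vector_Spaces.linear s (*s) \<phi>" and "bij \<phi>"
  shows "given_by_matrix s (\<lambda>i. inv \<phi> (bv i)) M (\<lambda>x. inv \<phi> (M *v \<phi> x))"
proof -
  have inv: "Vector_Spaces.linear (*s) s (inv \<phi>)" by (rule linear_inv) fact+
  interpret inv: Vector_Spaces.linear "(*s)" s "inv \<phi>" by fact
  have "Vector_Spaces.linear s s (\<lambda>x. inv \<phi> (M *v \<phi> x))"
    using Vector_Spaces.linear_compose[OF Vector_Spaces.linear_compose[OF \<phi> matrix_vector_mul_linear_gen] inv]
    by (simp add: comp_def)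
  moreover have "M *v bv j = (\<Sum>i\<in>UNIV. M $ i $ j *s bv i)" for j
    by (simp add: vec_eq_iff matrix_vector_mult_def bv_nth if_distrib cong: if_cong)
  moreover have "\<phi> (inv \<phi> y) = y" for y using \<open>bij \<phi>\<close> by (simp add: bij_def surj_f_inv_f)
  ultimately show ?thesis
    by (simp add: given_by_matrix_def inv.sum inv.scale)
qed

lemma superderivation_conjugate:
  assumes iso: "i_isomorphism L B L' B' \<phi>" and \<delta>: "even_superderivation L' \<delta>"
  shows "even_superderivation L (\<lambda>x. inv \<phi> (\<delta> (\<phi> x)))"
proof -
  have \<phi>: "Vector_Spaces.linear (scl L) (scl L') \<phi>" and "bij \<phi>"
    and gr: "\<And>i. \<phi> ` grade L i = grade L' i"
    and brk: "\<And>X Y. \<phi> (brk L X Y) = brk L' (\<phi> X) (\<phi> Y)"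
    using iso by (auto simp: i_isomorphism_def)
  have lin: "Vector_Spaces.linear (scl L') (scl L') \<delta>"
    and der: "\<And>X Y. \<delta> (brk L' X Y) = brk L' (\<delta> X) Y + brk L' X (\<delta> Y)"
    and ev: "\<And>X i. X \<in> grade L' i \<Longrightarrow> \<delta> X \<in> grade L' i"
    using \<delta> by (auto simp: even_superderivation_def)
  have inj: "inj \<phi>" and [simp]: "\<phi> (inv \<phi> y) = y" for y
    using \<open>bij \<phi>\<close> by (simp_all add: bij_def surj_f_inv_f)
  have "inv \<phi> (\<delta> (\<phi> x)) \<in> grade L i" if "x \<in> grade L i" for x i
  proof -
    have "\<delta> (\<phi> x) \<in> \<phi> ` grade L i" using that gr ev by blast
    then show ?thesis using inj by auto
  qed
  moreover have "inv \<phi> (\<delta> (\<phi> (brk L X Y))) =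
      brk L (inv \<phi> (\<delta> (\<phi> X))) Y + brk L X (inv \<phi> (\<delta> (\<phi> Y)))" for X Y
    by (rule injD[OF inj]) (simp add: brk der linear_homs[OF \<phi>])
  moreover have "Vector_Spaces.linear (scl L) (scl L) (\<lambda>x. inv \<phi> (\<delta> (\<phi> x)))"
    using Vector_Spaces.linear_compose[OF Vector_Spaces.linear_compose[OF \<phi> lin] linear_inv[OF \<phi> \<open>bij \<phi>\<close>]]
    by (simp add: comp_def)
  ultimately show ?thesis by (auto simp: even_superderivation_def)
qed

lemma skew_supersymmetric_conjugate:
  assumes iso: "i_isomorphism L B L' B' \<phi>" and \<delta>: "skew_supersymmetric B' \<delta>"
  shows "skew_supersymmetric B (\<lambda>x. inv \<phi> (\<delta> (\<phi> x)))"
proof -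
  have B: "\<And>X Y. B X Y = B' (\<phi> X) (\<phi> Y)" and "bij \<phi>"
    using iso by (auto simp: i_isomorphism_def)
  then have "\<phi> (inv \<phi> y) = y" for y by (simp add: bij_def surj_f_inv_f)
  then show ?thesis using \<delta> by (simp add: skew_supersymmetric_def B)
qed

section \<open>The diagonal superderivation of \<open>g8\<close>\<close>

lemma delta_matrix_mult_nth:
  "(delta_matrix *v x) $ FX0 = 2 * x $ FX0" "(delta_matrix *v x) $ FX1 = - 2 * x $ FX1"
  "(delta_matrix *v x) $ Fe = - 2 * x $ Fe" "(delta_matrix *v x) $ Fes = 2 * x $ Fes"
  "(delta_matrix *v x) $ FY1 = x $ FY1" "(delta_matrix *v x) $ FY2 = - x $ FY2"
  "(delta_matrix *v x) $ FY3 = x $ FY3" "(delta_matrix *v x) $ FY4 = - x $ FY4"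
  by (simp_all add: delta_matrix_def matrix_vector_mult_def sum8 matrix_unit_def scaleR_conv_of_real)

text \<open>The matrix is diagonal with nonzero diagonal entries, so the inverse divides by
  them.\<close>

lemma bij_delta_matrix: "bij ((*v) delta_matrix)"
  by (rule bij_betw_byWitness[where f' = "\<lambda>x. \<chi> i. x $ i / delta_matrix $ i $ i"])
    (simp_all add: vec_eq_iff all8 delta_matrix_mult_nth,
      simp_all add: delta_matrix_def matrix_unit_def scaleR_conv_of_real)

text \<open>The weights are 2 on \<open>FX0\<close>, \<open>Fes\<close>, -2 on \<open>FX1\<close>,
  \<open>Fe\<close>, 1 on \<open>FY1\<close>, \<open>FY3\<close> and -1 on \<open>FY2\<close>,
  \<open>FY4\<close>. Nonzero brackets add weights, as -2 + 1 = -1 or 1 + 1 = 2, for every choice of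
  the parameters.\<close>

lemma delta_matrix_superderivation: "even_superderivation (g8 b2 b4 c2) ((*v) delta_matrix)"
proof -
  have "delta_matrix *v X \<in> grade (g8 b2 b4 c2) i" if "X \<in> grade (g8 b2 b4 c2) i" for X i
    using that by (simp add: g8_def table_superalgebra_def all8 delta_matrix_mult_nth)
  moreover have "delta_matrix *v brk (g8 b2 b4 c2) X Y =
      brk (g8 b2 b4 c2) (delta_matrix *v X) Y + brk (g8 b2 b4 c2) X (delta_matrix *v Y)" for X Y
    by (simp add: brk_g8 vec_eq_iff all8 delta_matrix_mult_nth bv_nth algebra_simps)
  ultimately show ?thesis
    by (auto simp: even_superderivation_def g8_def scl_table matrix_vector_mul_linear_gen)
qed

lemma delta_matrix_skew: "skew_supersymmetric B8 ((*v) delta_matrix)"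
  by (simp add: skew_supersymmetric_def B8_def table_form_def sum8 delta_matrix_mult_nth)

theorem proposition4p4:
  fixes b1' b2' b4' c2' c3' :: complex
    and D :: "complex ^ basis6 \<Rightarrow> complex ^ basis6"
  assumes "b1' \<noteq> 0" and "c3' \<noteq> 0" and "b1' \<noteq> - c3'"
    and "quadratic_symplectic g64 B64 (omega64 b1' b2' b4' c2' c3')"
    and "even_superderivation g64 D" and "skew_supersymmetric B64 D" and "nilpotent_map D"
  shows
    "(\<exists>\<omega>. quadratic_symplectic (double_ext g64 B64 D) (double_ext_form B64) \<omega>) \<and>
     (\<exists>b2 b4 c2 \<phi>.
        (b2, b4, c2) \<noteq> (0, 0, 0) \<and>
        i_isomorphism (double_ext g64 B64 D) (double_ext_form B64) (g8 b2 b4 c2) B8 \<phi> \<and>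
        (\<exists>\<delta>.
           given_by_matrix (scl (double_ext g64 B64 D)) (\<lambda>i. inv \<phi> (bv i)) delta_matrix \<delta> \<and>
           even_superderivation (double_ext g64 B64 D) \<delta> \<and>
           bij \<delta> \<and>
           skew_supersymmetric (double_ext_form B64) \<delta> \<and>
           quadratic_symplectic (double_ext g64 B64 D) (double_ext_form B64)
             (\<lambda>X Y. double_ext_form B64 (\<delta> X) Y)))"
proof -
  obtain d2 b4 c2 where D: "D = der6 d2 b4 c2"
    using nilpotent_superderivation_g64 assms(5-7) by metis
  \<comment> \<open>The shift is chosen so that \<open>d2 + (1 - d2) = 1\<close> is the first
    parameter of the target.\<close>
  define \<phi> where "\<phi> = ext_to_g8 (1 - d2)"
  let ?L = "double_ext g64 B64 D" and ?B = "double_ext_form B64"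
  \<comment> \<open>One conjugated map supplies both the required superderivation and, through it,
    the symplectic form on the extension.\<close>
  let ?\<delta> = "\<lambda>x. inv \<phi> (delta_matrix *v \<phi> x)"
  have iso: "i_isomorphism ?L ?B (g8 1 b4 c2) B8 \<phi>"
    unfolding D \<phi>_def using ext_to_g8_i_isomorphism[of d2 b4 c2 "1 - d2"] by simp
  then have lin: "Vector_Spaces.linear (scl ?L) (*s) \<phi>" and "bij \<phi>" and Q: "quadratic ?L ?B"
    by (auto simp: i_isomorphism_def g8_def scl_table)
  have "given_by_matrix (scl ?L) (\<lambda>i. inv \<phi> (bv i)) delta_matrix ?\<delta>"
    by (rule given_by_matrix_conjugate) fact+
  moreover have der: "even_superderivation ?L ?\<delta>"
    by (rule superderivation_conjugate[OF iso delta_matrix_superderivation])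
  moreover have bij: "bij ?\<delta>"
    using bij_comp[OF bij_comp[OF \<open>bij \<phi>\<close> bij_delta_matrix] bij_imp_bij_inv[OF \<open>bij \<phi>\<close>]]
    by (simp add: comp_def)
  moreover have skew: "skew_supersymmetric ?B ?\<delta>"
    by (rule skew_supersymmetric_conjugate[OF iso delta_matrix_skew])
  moreover note symp = symplectic_of_superderivation[OF Q der bij skew]
  moreover have "(1 :: complex, b4, c2) \<noteq> (0, 0, 0)" by simp
  ultimately show ?thesis using iso by blast
qed

end
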